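(* Let $\rho$ be a symmetric probability measure on $\mathbb{R}$ with positive variance $\sigma^2$ and such that $$\exists v_0>0\qquad \int_{\mathbb{R}} e^{v_0z^2}\,d\rho(z)<+\infty.$$ Suppose that one of the following conditions holds: (a) $\rho$ has a density (with respect to Lebesgue measure); (b) $\rho$ is the sum of a finite number of (weighted) Dirac masses; (c) there exists $c>0$ such that $\rho(]0,c[)=0$; (d) $\rho(\{0\})<1/\sqrt{e}$. Then, under $\tilde\mu_{n,\rho}$, the pair $(S_n/n,T_n/n)$ converges in probability toward $(0,\sigma^2)$ as $n\to\infty$; that is, for every open neighborhood $U$ of $(0,\sigma^2)$ in $\mathbb{R}^2$, $\tilde\mu_{n,\rho}\big((S_n/n,T_n/n)\in U^c\big)\to 0$.
   Context: A probability measure $\rho$ on $\mathbb{R}$ is symmetric if $\rho(A)=\rho(-A)$ for every Borel set $A$. For a probability measure $\rho$ on $\mathbb{R}$ that is not the Dirac mass at $0$ and $n\ge1$, $\tilde\mu_{n,\rho}$ denotes the probability measure on $\mathbb{R}^n$ given by $$d\tilde\mu_{n,\rho}(x_1,\ldots,x_n)=\frac1{Z_n}\exp\Big(\frac12\,\frac{(x_1+\cdots+x_n)^2}{x_1^2+\cdots+x_n^2}\Big)\mathbf 1_{\{x_1^2+\cdots+x_n^2>0\}}\prod_{i=1}^n d\rho(x_i),$$ where $Z_n$ is the normalizing constant. For each $n$, $(X_n^1,\ldots,X_n^n)$ is a random vector with law $\tilde\mu_{n,\rho}$, and $S_n=X_n^1+\cdots+X_n^n$, $T_n=(X_n^1)^2+\cdots+(X_n^n)^2$.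 $]a,b[$ denotes the open interval. *)

theory Defs
  imports "HOL-Probability.Probability"
begin

definition symmetric_measure :: "real measure \<Rightarrow> bool" where
  "symmetric_measure \<rho> \<longleftrightarrow> (\<forall>A\<in>sets borel. emeasure \<rho> A = emeasure \<rho> (uminus ` A))"

definition has_lebesgue_density :: "real measure \<Rightarrow> bool" where
  "has_lebesgue_density \<rho> \<longleftrightarrow> (\<exists>f\<in>borel_measurable lborel. \<rho> = density lborel f)"

definition finite_sum_of_diracs :: "real measure \<Rightarrow> bool" where
  "finite_sum_of_diracs \<rho> \<longleftrightarrow>
     (\<exists>(F :: real set) (w :: real \<Rightarrow> ennreal). finite F \<and>
        (\<forall>A\<in>sets borel. emeasure \<rho> A = (\<Sum>a\<in>F. w a * emeasure (return borel a) A)))"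

text \<open>Points of \<open>\<real>\<^sup>n\<close> are functions on the index set \<open>{1..n}\<close>, as in the product measure
  \<open>Pi\<^sub>M {1..n} (\<lambda>_. \<rho>)\<close>.\<close>

definition S :: "nat \<Rightarrow> (nat \<Rightarrow> real) \<Rightarrow> real" where
  "S n x = (\<Sum>i\<in>{1..n}. x i)"

definition T :: "nat \<Rightarrow> (nat \<Rightarrow> real) \<Rightarrow> real" where
  "T n x = (\<Sum>i\<in>{1..n}. (x i)\<^sup>2)"

definition weight :: "nat \<Rightarrow> (nat \<Rightarrow> real) \<Rightarrow> real" where
  "weight n x = exp (1 / 2 * ((S n x)\<^sup>2 / T n x)) * indicator {y. T n y > 0} x"

definition Z :: "real measure \<Rightarrow> nat \<Rightarrow> real" where
  "Z \<rho> n = (\<integral>x. weight n x \<partial>Pi\<^sub>M {1..n} (\<lambda>_. \<rho>))"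

definition mu_tilde :: "real measure \<Rightarrow> nat \<Rightarrow> (nat \<Rightarrow> real) measure" where
  "mu_tilde \<rho> n = density (Pi\<^sub>M {1..n} (\<lambda>_. \<rho>)) (\<lambda>x. ennreal (1 / Z \<rho> n * weight n x))"

text \<open>The integral defining \<open>Z\<close> converges and is positive, so the normalization is genuine.\<close>

lemma weight_measurable:
  assumes "real_distribution \<rho>"
  shows "weight n \<in> borel_measurable (Pi\<^sub>M {1..n} (\<lambda>_. \<rho>))"
proof -
  interpret real_distribution \<rho> by fact
  have c: "(\<lambda>x. x i) \<in> borel_measurable (Pi\<^sub>M {1..n} (\<lambda>_. \<rho>))" if "i \<in> {1..n}" for i
  proof -
    have "(\<lambda>x. x i) \<in> measurable (Pi\<^sub>M {1..n} (\<lambda>_. \<rho>)) \<rho>"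
      using that by (rule measurable_component_singleton)
    then show ?thesis
      by (simp cong: measurable_cong_sets)
  qed
  have S: "S n \<in> borel_measurable (Pi\<^sub>M {1..n} (\<lambda>_. \<rho>))"
    unfolding S_def[abs_def] by (rule borel_measurable_sum) (rule c)
  have T: "T n \<in> borel_measurable (Pi\<^sub>M {1..n} (\<lambda>_. \<rho>))"
    unfolding T_def[abs_def] by (intro borel_measurable_sum borel_measurable_power c)
  have eq: "weight n = (\<lambda>x. exp (1 / 2 * ((S n x)\<^sup>2 / T n x)) * (if T n x > 0 then 1 else 0))"
    by (auto simp: weight_def indicator_def)
  show ?thesis
    unfolding eq using S T by measurable
qed

lemma weight_nonneg: "0 \<le> weight n x"
  by (simp add: weight_def)

lemma weight_le: "weight n x \<le> exp (real n / 2)"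
proof (cases "T n x > 0")
  case True
  have "(S n x)\<^sup>2 \<le> T n x * real n"
    unfolding S_def T_def
    using Cauchy_Schwarz_ineq_sum[of x "\<lambda>_. 1" "{1..n}"] by simp
  then have "(S n x)\<^sup>2 / T n x \<le> real n"
    using True by (simp add: field_simps)
  then show ?thesis
    by (simp add: weight_def indicator_def)
qed (simp add: weight_def)

lemma weight_integrable:
  assumes "real_distribution \<rho>"
  shows "integrable (Pi\<^sub>M {1..n} (\<lambda>_. \<rho>)) (weight n)"
proof -
  interpret real_distribution \<rho> by fact
  interpret P: prob_space "Pi\<^sub>M {1..n} (\<lambda>_. \<rho>)"
    by (intro prob_space_PiM) (rule prob_space_axioms)
  show ?thesis
    by (rule P.integrable_const_bound[where B = "exp (real n / 2)"])
       (use weight_measurable[OF assms] in \<open>auto simp: weight_nonneg weight_le\<close>)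
qed

lemma Z_pos:
  assumes \<rho>: "real_distribution \<rho>" and nd: "\<rho> \<noteq> return borel 0" and n: "n \<ge> 1"
  shows "Z \<rho> n > 0"
proof (rule ccontr)
  interpret real_distribution \<rho> by fact
  let ?P = "Pi\<^sub>M {1..n} (\<lambda>_. \<rho>)"
  assume "\<not> Z \<rho> n > 0"
  moreover have "Z \<rho> n \<ge> 0"
    unfolding Z_def by (intro Bochner_Integration.integral_nonneg) (simp add: weight_nonneg)
  ultimately have "Z \<rho> n = 0" by simp
  then have "AE x in ?P. weight n x = 0"
    unfolding Z_def
    by (subst (asm) integral_nonneg_eq_0_iff_AE[OF weight_integrable[OF \<rho>]])
       (auto simp: weight_nonneg)
  then have "AE x in ?P. x 1 = 0"
  proof eventually_elim
    case (elim x)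
    then have "T n x \<le> 0" by (auto simp: weight_def indicator_def split: if_splits)
    moreover have "(x 1)\<^sup>2 \<le> T n x"
      unfolding T_def using n by (intro member_le_sum) auto
    ultimately have "(x 1)\<^sup>2 \<le> 0" by linarith
    then show ?case by simp
  qed
  then have AE1: "AE x in ?P. x 1 = 0" .
  have m: "(\<lambda>x. x 1) \<in> measurable ?P \<rho>"
    using n by (intro measurable_component_singleton) auto
  have d: "distr ?P \<rho> (\<lambda>x. x 1) = \<rho>"
    using n by (intro distr_PiM_component) (auto intro: prob_space_axioms)
  have "AE z in distr ?P \<rho> (\<lambda>x. x 1). z = 0"
    by (subst AE_distr_iff[OF m]) (use AE1 in auto)
  then have AE0: "AE z in \<rho>. z = 0"
    unfolding d .
  have "\<rho> = return borel 0"
  proof (rule measure_eqI)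
    fix A assume A: "A \<in> sets \<rho>"
    have "emeasure \<rho> A = emeasure \<rho> {z \<in> space \<rho>. 0 \<in> A}"
      using A AE0
      by (intro emeasure_eq_AE) auto
    also have "\<dots> = emeasure (return borel 0) A"
      using A emeasure_space_1 by (cases "0 \<in> A") auto
    finally show "emeasure \<rho> A = emeasure (return borel 0) A" .
  qed simp
  then show False using nd by simp
qed

lemma prob_space_mu_tilde:
  assumes \<rho>: "real_distribution \<rho>" and nd: "\<rho> \<noteq> return borel 0" and n: "n \<ge> 1"
  shows "prob_space (mu_tilde \<rho> n)"
proof
  let ?P = "Pi\<^sub>M {1..n} (\<lambda>_. \<rho>)"
  have m: "(\<lambda>x. ennreal (1 / Z \<rho> n * weight n x)) \<in> borel_measurable ?P"
    using weight_measurable[OF \<rho>] by measurable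
  have "emeasure (mu_tilde \<rho> n) (space (mu_tilde \<rho> n))
      = (\<integral>\<^sup>+x. ennreal (1 / Z \<rho> n * weight n x) \<partial>?P)"
    unfolding mu_tilde_def using m
    by (subst emeasure_density) (auto simp: nn_integral_set_ennreal intro!: nn_integral_cong)
  also have "\<dots> = ennreal (\<integral>x. 1 / Z \<rho> n * weight n x \<partial>?P)"
    using Z_pos[OF assms] weight_integrable[OF \<rho>]
    by (intro nn_integral_eq_integral) (auto simp: weight_nonneg)
  also have "(\<integral>x. 1 / Z \<rho> n * weight n x \<partial>?P) = 1"
    using Z_pos[OF assms] by (simp add: Z_def)
  finally show "emeasure (mu_tilde \<rho> n) (space (mu_tilde \<rho> n)) = 1" by simp
qed

end

theory Submission
  imports Defs
begin

text \<open>
  Write \<open>m = \<sigma>\<^sup>2 = E z\<^sup>2\<close>, and let \<open>P n\<close> be the product measure before reweighting. Since the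
  weight is at least 1 where \<open>T > 0\<close>, the law of large numbers for \<open>T / n\<close> keeps \<open>Z\<close> bounded away
  from 0, and it suffices that the unnormalised mass of the complement of a small box around
  \<open>(0, m)\<close> tends to 0. That complement is covered by two regions, and in each the exponent
  \<open>S\<^sup>2 / (2 T)\<close> is linearised in its own way.

  Region \<open>\<bar>T / n - m\<bar> \<ge> d\<close>. Put \<open>W = S / sqrt T\<close>, so that \<open>\<bar>W\<bar> \<le> sqrt n\<close> by Cauchy-Schwarz.
  Up to a constant factor \<open>exp (W\<^sup>2 / 2)\<close> is at most the sum of \<open>exp (j W - j\<^sup>2 / 2)\<close> over the integers
  \<open>\<bar>j\<bar> \<le> sqrt n\<close>. By symmetry the signs of the coordinates may be averaged out with \<open>T\<close> held fixed,
  and \<open>cosh y \<le> exp (y\<^sup>2 / 2)\<close> bounds the average of each term by 1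
  (\<open>nn_integral_exp_tilt_le\<close>). Hence the reweighting costs only a factor of order \<open>sqrt n\<close>
  on any event that depends on \<open>T\<close> alone (\<open>nn_integral_weight_T_in_le\<close>), however small \<open>T\<close> is.
  By Chebyshev the event has \<open>P n\<close>-probability \<open>O(1 / n)\<close>, which beats this factor.

  Region \<open>\<bar>T / n - m\<bar> < d\<close>, \<open>\<bar>S / n\<bar> \<ge> e\<close>. Here the slope \<open>S / T\<close> lies in a compact set that
  does not contain 0, and \<open>S\<^sup>2 / (2 T) = u S - u\<^sup>2 T / 2 + T (S / T - u)\<^sup>2 / 2\<close>. For fixed \<open>u \<noteq> 0\<close>
  the first two terms contribute the \<open>n\<close>-th power of \<open>E exp (u z - u\<^sup>2 z\<^sup>2 / 2)\<close>, which is less than 1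
  because by symmetry it is the mean of \<open>cosh (u z) exp (- u\<^sup>2 z\<^sup>2 / 2)\<close>. Finitely many \<open>u\<close> with
  small enough error terms cover the compact set, so this region has exponentially small mass
  (\<open>nn_integral_weight_slope_tendsto_0\<close>).
\<close>

(* Index sets stay in the form {1..n} under simplification. *)
declare One_nat_def [simp del]

section \<open>Gaussian comparison inequalities\<close>

text \<open>The derivative of \<open>cosh s * exp (- s\<^sup>2 / 2)\<close> is nonpositive for \<open>s \<ge> 0\<close> because
  \<open>sinh s \<le> s * cosh s\<close> there.\<close>

lemma cosh_le_exp_half_square: "cosh x \<le> exp (x\<^sup>2 / 2)" for x :: real
proof -
  have *: "cosh y \<le> exp (y\<^sup>2 / 2)" if "0 \<le> y" for y :: real
  proof -
    have sinh_le: "0 * cosh 0 - sinh 0 \<le> t * cosh t - sinh t" if "0 \<le> t" for t :: real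
    proof (rule DERIV_nonneg_imp_nondecreasing[OF that])
      fix s :: real assume "0 \<le> s"
      then show "\<exists>d. ((\<lambda>s. s * cosh s - sinh s) has_real_derivative d) (at s) \<and> 0 \<le> d"
        by (intro exI[of _ "s * sinh s"] conjI) (auto intro!: derivative_eq_intros)
    qed
    have "cosh y * exp (- (y\<^sup>2 / 2)) \<le> cosh 0 * exp (- (0\<^sup>2 / 2))"
    proof (rule DERIV_nonpos_imp_nonincreasing[OF that])
      fix s :: real assume "0 \<le> s"
      then have "(sinh s - s * cosh s) * exp (- (s\<^sup>2 / 2)) \<le> 0"
        using sinh_le[of s] by (simp add: mult_nonpos_nonneg)
      moreover have "((\<lambda>s. cosh s * exp (- (s\<^sup>2 / 2))) has_real_derivative
          (sinh s - s * cosh s) * exp (- (s\<^sup>2 / 2))) (at s)"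
        by (auto intro!: derivative_eq_intros simp: algebra_simps)
      ultimately show "\<exists>d. ((\<lambda>s. cosh s * exp (- (s\<^sup>2 / 2))) has_real_derivative d) (at s) \<and> d \<le> 0"
        by blast
    qed
    then show ?thesis
      by (simp add: exp_minus field_simps)
  qed
  show ?thesis
    using *[of x] *[of "- x"] by (cases "0 \<le> x") auto
qed

text \<open>The half-angle formula turns the weak inequality into the strict one: with
  \<open>t = exp (x\<^sup>2 / 4) > 1\<close> the weak inequality at \<open>x / 2\<close> gives \<open>cosh x \<le> 2 t - 1 < t\<^sup>2\<close>.\<close>

lemma cosh_less_exp_half_square:
  fixes x :: real
  assumes "x \<noteq> 0"
  shows "cosh x < exp (x\<^sup>2 / 2)"
proof -
  define t where "t = exp (x\<^sup>2 / 4)"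
  have "t > 1" using assms by (simp add: t_def)
  have "cosh x = 2 * (cosh (x / 2))\<^sup>2 - 1"
    using cosh_double_cosh[of "x / 2"] by simp
  also have "(cosh (x / 2))\<^sup>2 \<le> (exp ((x / 2)\<^sup>2 / 2))\<^sup>2"
    by (intro power_mono cosh_le_exp_half_square) simp
  also have "\<dots> = t"
    by (simp add: t_def power2_eq_square flip: exp_add)
  also have "2 * t - 1 < t * t"
    using \<open>t > 1\<close> mult_pos_pos[of "t - 1" "t - 1"] by (simp add: algebra_simps)
  also have "t * t = exp (x\<^sup>2 / 2)"
    by (simp add: t_def flip: exp_add)
  finally show ?thesis by simp
qed

text \<open>A discrete substitute for the Gaussian integral representation of \<open>exp (w\<^sup>2 / 2)\<close>: the tangent
  of \<open>w\<^sup>2 / 2\<close> at an integer within distance 1 of \<open>w\<close> is at most \<open>1 / 2\<close> below it at \<open>w\<close>.\<close>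

lemma exp_half_square_le_sum_exp_affine:
  fixes w :: real
  assumes "\<bar>w\<bar> \<le> r"
  shows "exp (w\<^sup>2 / 2) \<le> exp (1 / 2) * (\<Sum>j\<in>{-\<lfloor>r\<rfloor>..\<lfloor>r\<rfloor>}. exp (of_int j * w - (of_int j)\<^sup>2 / 2))"
proof -
  \<comment> \<open>Rounding towards 0 keeps \<open>j\<close> inside the range of summation.\<close>
  define j where "j = (if 0 \<le> w then \<lfloor>w\<rfloor> else \<lceil>w\<rceil>)"
  have near: "\<bar>w - of_int j\<bar> \<le> 1"
    unfolding j_def by (auto; linarith)
  have j: "j \<in> {-\<lfloor>r\<rfloor>..\<lfloor>r\<rfloor>}"
  proof (cases "0 \<le> w")
    case True
    then have "0 \<le> \<lfloor>w\<rfloor>" "\<lfloor>w\<rfloor> \<le> \<lfloor>r\<rfloor>"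
      using floor_mono[of w r] assms by simp_all
    then have "- \<lfloor>r\<rfloor> \<le> \<lfloor>w\<rfloor>" "\<lfloor>w\<rfloor> \<le> \<lfloor>r\<rfloor>"
      by linarith+
    then show ?thesis
      using True by (simp add: j_def)
  next
    case False
    then have "\<lceil>w\<rceil> \<le> 0" "- \<lceil>w\<rceil> \<le> \<lfloor>r\<rfloor>"
      using floor_mono[of "- w" r] assms by (simp_all add: floor_minus)
    then have "- \<lfloor>r\<rfloor> \<le> \<lceil>w\<rceil>" "\<lceil>w\<rceil> \<le> \<lfloor>r\<rfloor>"
      by linarith+
    then show ?thesis
      using False by (simp add: j_def)
  qed
  have "w\<^sup>2 / 2 = (of_int j * w - (of_int j)\<^sup>2 / 2) + (w - of_int j)\<^sup>2 / 2"
    by (simp add: power2_eq_square field_simps)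
  also have "(w - of_int j)\<^sup>2 \<le> 1"
    using near by (simp add: abs_square_le_1)
  finally have "exp (w\<^sup>2 / 2) \<le> exp (1 / 2 + (of_int j * w - (of_int j)\<^sup>2 / 2))"
    by simp
  also have "\<dots> = exp (1 / 2) * exp (of_int j * w - (of_int j)\<^sup>2 / 2)"
    by (rule exp_add)
  also have "exp (of_int j * w - (of_int j)\<^sup>2 / 2)
      \<le> (\<Sum>j\<in>{-\<lfloor>r\<rfloor>..\<lfloor>r\<rfloor>}. exp (of_int j * w - (of_int j)\<^sup>2 / 2))"
    by (rule member_le_sum[OF j]) auto
  finally show ?thesis by simp
qed

section \<open>Sums and sums of squares of a vector\<close>

lemma S_square_le: "(S n x)\<^sup>2 \<le> real n * T n x"
  unfolding S_def T_def
  using Cauchy_Schwarz_ineq_sum[of x "\<lambda>_. 1" "{1..n}"] by (simp add: mult.commute)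

definition flip_signs :: "nat set \<Rightarrow> (nat \<Rightarrow> real) \<Rightarrow> nat \<Rightarrow> real" where
  "flip_signs J x = (\<lambda>i. if i \<in> J then - x i else x i)"

lemma T_flip_signs [simp]: "T n (flip_signs J x) = T n x"
  unfolding T_def flip_signs_def by (intro sum.cong) auto

text \<open>Summed over all sign patterns the exponential factorises into
  \<open>2 cosh (l x\<^sub>i) exp (- (l x\<^sub>i)\<^sup>2 / 2)\<close>, and each factor is at most 2.\<close>

lemma sum_exp_flip_signs_le:
  "(\<Sum>J\<in>Pow {1..n}. exp (l * S n (flip_signs J x) - l\<^sup>2 * T n x / 2)) \<le> 2 ^ n"
proof -
  define a where "a i = exp (- (l * x i) - (l * x i)\<^sup>2 / 2)" for i
  define b where "b i = exp (l * x i - (l * x i)\<^sup>2 / 2)" for i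
  have "exp (l * S n (flip_signs J x) - l\<^sup>2 * T n x / 2) = prod a J * prod b ({1..n} - J)"
    if J: "J \<subseteq> {1..n}" for J
  proof -
    have "l * S n (flip_signs J x) - l\<^sup>2 * T n x / 2
        = (\<Sum>i\<in>{1..n}. l * flip_signs J x i - (l * x i)\<^sup>2 / 2)"
      by (simp add: S_def T_def sum_subtractf sum_distrib_left sum_divide_distrib power_mult_distrib)
    also have "exp \<dots> = (\<Prod>i\<in>{1..n}. exp (l * flip_signs J x i - (l * x i)\<^sup>2 / 2))"
      by (simp add: exp_sum)
    also have "\<dots> = (\<Prod>i\<in>{1..n} - J. exp (l * flip_signs J x i - (l * x i)\<^sup>2 / 2))
        * (\<Prod>i\<in>J. exp (l * flip_signs J x i - (l * x i)\<^sup>2 / 2))"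
      by (rule prod.subset_diff[OF J]) simp
    also have "\<dots> = prod b ({1..n} - J) * prod a J"
      by (intro arg_cong2[where f = "(*)"] prod.cong) (auto simp: a_def b_def flip_signs_def)
    finally show ?thesis by (simp only: mult.commute)
  qed
  then have "(\<Sum>J\<in>Pow {1..n}. exp (l * S n (flip_signs J x) - l\<^sup>2 * T n x / 2))
      = (\<Sum>J\<in>Pow {1..n}. prod a J * prod b ({1..n} - J))"
    by (intro sum.cong) auto
  also have "\<dots> = (\<Prod>i\<in>{1..n}. a i + b i)"
    by (rule prod_add[symmetric]) simp
  also have "\<dots> \<le> (\<Prod>i\<in>{1..n}. 2)"
  proof (rule prod_mono)
    fix i
    have "exp (p - q) = exp p * exp (- q)" for p q :: real
      by (simp flip: exp_add)
    then have "a i + b i = 2 * cosh (l * x i) * exp (- ((l * x i)\<^sup>2 / 2))"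
      by (simp only: a_def b_def cosh_def) (simp add: algebra_simps)
    also have "\<dots> \<le> 2 * exp ((l * x i)\<^sup>2 / 2) * exp (- ((l * x i)\<^sup>2 / 2))"
      by (intro mult_right_mono mult_left_mono cosh_le_exp_half_square) auto
    also have "\<dots> = 2"
      by (simp flip: exp_add)
    finally show "0 \<le> a i + b i \<and> a i + b i \<le> 2"
      by (simp add: a_def b_def)
  qed
  finally show ?thesis by simp
qed

section \<open>Product measures of a symmetric distribution\<close>

locale symmetric_distribution = real_distribution \<rho> for \<rho> +
  assumes symmetric: "symmetric_measure \<rho>"
begin

abbreviation P :: "nat \<Rightarrow> (nat \<Rightarrow> real) measure" where
  "P n \<equiv> Pi\<^sub>M {1..n} (\<lambda>_. \<rho>)"

lemma prob_space_P: "prob_space (P n)"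
  by (intro prob_space_PiM) (rule prob_space_axioms)

lemma product_prob_space_P: "product_prob_space (\<lambda>_. \<rho>)"
  by unfold_locales

lemma component_measurable: "i \<in> {1..n} \<Longrightarrow> (\<lambda>x. x i) \<in> borel_measurable (P n)"
  using measurable_component_singleton[of i "{1..n}" "\<lambda>_. \<rho>"] by (simp cong: measurable_cong_sets)

lemma S_measurable [measurable]: "S n \<in> borel_measurable (P n)"
  unfolding S_def[abs_def] by (rule borel_measurable_sum) (rule component_measurable)

lemma T_measurable [measurable]: "T n \<in> borel_measurable (P n)"
  unfolding T_def[abs_def] by (intro borel_measurable_sum borel_measurable_power component_measurable)

lemma emeasure_uminus_vimage:
  assumes "A \<in> sets borel"
  shows "emeasure \<rho> (uminus -` A) = emeasure \<rho> A"
proof -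
  have "uminus -` A = uminus ` A" for A :: "real set"
    by (force simp: image_iff)
  then show ?thesis
    using symmetric assms by (simp add: symmetric_measure_def)
qed

lemma distr_uminus: "distr \<rho> borel uminus = \<rho>"
  by (rule measure_eqI) (auto simp: emeasure_distr emeasure_uminus_vimage)

lemma flip_signs_measurable [measurable]:
  assumes "J \<subseteq> {1..n}"
  shows "flip_signs J \<in> measurable (P n) (P n)"
  unfolding flip_signs_def[abs_def]
proof (rule measurable_PiM_single')
  fix i assume i: "i \<in> {1..n}"
  have "(\<lambda>x. if i \<in> J then - x i else x i) \<in> borel_measurable (P n)"
    using component_measurable[OF i] by auto
  then show "(\<lambda>x. if i \<in> J then - x i else x i) \<in> measurable (P n) \<rho>"
    by (simp cong: measurable_cong_sets)
next
  show "(\<lambda>x i. if i \<in> J then - x i else x i) \<in> space (P n) \<rightarrow> (\<Pi>\<^sub>E i\<in>{1..n}. space \<rho>)"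
    using assms by (auto simp: space_PiM PiE_def extensional_def)
qed

lemma distr_flip_signs:
  assumes "J \<subseteq> {1..n}"
  shows "distr (P n) (P n) (flip_signs J) = P n"
proof -
  interpret prod: product_prob_space "\<lambda>_. \<rho>" "{1..n}"
    by (rule product_prob_space_P)
  show ?thesis
  proof (rule prod.PiM_eqI)
    fix A :: "nat \<Rightarrow> real set"
    assume A: "\<And>i. i \<in> {1..n} \<Longrightarrow> A i \<in> sets \<rho>"
    define B where "B i = (if i \<in> J then uminus -` A i else A i)" for i
    have neg: "uminus -` A i \<in> sets borel" if "i \<in> {1..n}" for i
      using measurable_sets[of "uminus :: real \<Rightarrow> real" borel borel "A i"] A[OF that] by simp
    have "emeasure (distr (P n) (P n) (flip_signs J)) (Pi\<^sub>E {1..n} A)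
        = emeasure (P n) (flip_signs J -` Pi\<^sub>E {1..n} A \<inter> space (P n))"
      using A assms by (intro emeasure_distr flip_signs_measurable sets_PiM_I_finite) auto
    also have "flip_signs J -` Pi\<^sub>E {1..n} A \<inter> space (P n) = Pi\<^sub>E {1..n} B"
    proof (rule set_eqI)
      fix x
      have "flip_signs J x \<in> extensional {1..n}" if "x \<in> extensional {1..n}"
        using that assms by (auto simp: flip_signs_def extensional_def)
      moreover have "flip_signs J x i \<in> A i \<longleftrightarrow> x i \<in> B i" for i
        by (simp add: flip_signs_def B_def)
      ultimately show "x \<in> flip_signs J -` Pi\<^sub>E {1..n} A \<inter> space (P n) \<longleftrightarrow> x \<in> Pi\<^sub>E {1..n} B"
        by (auto simp: space_PiM PiE_iff)
    qed
    also have "emeasure (P n) \<dots> = (\<Prod>i\<in>{1..n}. emeasure \<rho> (B i))"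
      using A neg by (intro prod.emeasure_PiM) (auto simp: B_def)
    also have "\<dots> = (\<Prod>i\<in>{1..n}. emeasure \<rho> (A i))"
      using A by (intro prod.cong) (auto simp: B_def emeasure_uminus_vimage)
    finally show "emeasure (distr (P n) (P n) (flip_signs J)) (Pi\<^sub>E {1..n} A)
        = (\<Prod>i\<in>{1..n}. emeasure \<rho> (A i))" .
  qed auto
qed

text \<open>The self-normalised form of the sub-Gaussian bound. The tilt \<open>l\<close> may depend on \<open>T\<close> because
  flipping signs changes neither \<open>T\<close> nor \<open>P n\<close>, so the integrand can be replaced by its average
  over all sign patterns.\<close>

lemma nn_integral_exp_tilt_le:
  fixes f :: "real \<Rightarrow> ennreal" and l :: "real \<Rightarrow> real"
  assumes [measurable]: "f \<in> borel_measurable borel" "l \<in> borel_measurable borel"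
  shows "(\<integral>\<^sup>+x. f (T n x) * ennreal (exp (l (T n x) * S n x - (l (T n x))\<^sup>2 * T n x / 2)) \<partial>P n)
    \<le> (\<integral>\<^sup>+x. f (T n x) \<partial>P n)"
    (is "?L \<le> ?R")
proof -
  define g where
    "g x = f (T n x) * ennreal (exp (l (T n x) * S n x - (l (T n x))\<^sup>2 * T n x / 2))" for x
  have g [measurable]: "g \<in> borel_measurable (P n)"
    unfolding g_def by measurable
  have flip: "(\<integral>\<^sup>+x. g (flip_signs J x) \<partial>P n) = ?L" if "J \<in> Pow {1..n}" for J
  proof -
    have J: "J \<subseteq> {1..n}" using that by simp
    have "?L = (\<integral>\<^sup>+x. g x \<partial>distr (P n) (P n) (flip_signs J))"
      unfolding distr_flip_signs[OF J] by (simp add: g_def)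
    also have "\<dots> = (\<integral>\<^sup>+x. g (flip_signs J x) \<partial>P n)"
      by (intro nn_integral_distr flip_signs_measurable[OF J]) (use g in simp)
    finally show ?thesis ..
  qed
  have "ennreal (2 ^ n) * ?L = (\<Sum>J\<in>Pow {1..n}. \<integral>\<^sup>+x. g (flip_signs J x) \<partial>P n)"
    by (simp add: flip card_Pow ennreal_power flip: ennreal_numeral)
  also have "\<dots> = (\<integral>\<^sup>+x. (\<Sum>J\<in>Pow {1..n}. g (flip_signs J x)) \<partial>P n)"
    by (intro nn_integral_sum[symmetric] measurable_compose[OF flip_signs_measurable g]) auto
  also have "\<dots> \<le> (\<integral>\<^sup>+x. ennreal (2 ^ n) * f (T n x) \<partial>P n)"
  proof (rule nn_integral_mono)
    fix x
    have "(\<Sum>J\<in>Pow {1..n}. g (flip_signs J x)) = f (T n x) *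
        ennreal (\<Sum>J\<in>Pow {1..n}. exp (l (T n x) * S n (flip_signs J x) - (l (T n x))\<^sup>2 * T n x / 2))"
      by (simp add: g_def sum_ennreal flip: sum_distrib_left)
    also have "\<dots> \<le> f (T n x) * ennreal (2 ^ n)"
      by (intro mult_left_mono ennreal_leI sum_exp_flip_signs_le) simp
    finally show "(\<Sum>J\<in>Pow {1..n}. g (flip_signs J x)) \<le> ennreal (2 ^ n) * f (T n x)"
      by (simp add: mult.commute)
  qed
  also have "\<dots> = ennreal (2 ^ n) * ?R"
    by (rule nn_integral_cmult) measurable
  finally show ?thesis
    by (subst (asm) ennreal_mult_le_mult_iff) auto
qed

text \<open>Although the weight itself can be as large as \<open>exp (n / 2)\<close>, it increases the mass of an event
  about \<open>T\<close> by at most the number of integers in \<open>[- sqrt n, sqrt n]\<close>, up to a constant. The order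
  \<open>sqrt n\<close> matters: the cruder count of order \<open>n\<close> would not be beaten by Chebyshev's inequality.\<close>

lemma nn_integral_weight_T_in_le:
  assumes [measurable]: "B \<in> sets borel"
  shows "(\<integral>\<^sup>+x. ennreal (weight n x) * indicator B (T n x) \<partial>P n)
    \<le> ennreal (exp (1 / 2) * (2 * sqrt n + 1) * measure (P n) {x \<in> space (P n). T n x \<in> B})"
proof -
  interpret P: prob_space "P n" by (rule prob_space_P)
  define K :: "int set" where "K = {-\<lfloor>sqrt n\<rfloor>..\<lfloor>sqrt n\<rfloor>}"
  define l :: "int \<Rightarrow> real \<Rightarrow> real" where "l j t = of_int j / sqrt t" for j t
  define q where "q j x = exp (l j (T n x) * S n x - (l j (T n x))\<^sup>2 * T n x / 2)" for j x
  have l [measurable]: "l j \<in> borel_measurable borel" for j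
    unfolding l_def by measurable
  have q [measurable]: "q j \<in> borel_measurable (P n)" for j
    unfolding q_def by measurable
  have q_nonneg: "0 \<le> q j x" for j x
    by (simp add: q_def)
  have "weight n x \<le> exp (1 / 2) * (\<Sum>j\<in>K. q j x)" for x
  proof (cases "T n x > 0")
    case True
    define w where "w = S n x / sqrt (T n x)"
    have w2: "w\<^sup>2 = (S n x)\<^sup>2 / T n x"
      using True by (simp add: w_def power_divide)
    also have "\<dots> \<le> n"
      using S_square_le[of n x] True by (simp add: divide_le_eq)
    finally have "\<bar>w\<bar> \<le> sqrt n"
      by (simp add: real_le_rsqrt)
    moreover have "q j x = exp (of_int j * w - (of_int j)\<^sup>2 / 2)" for j
      using True by (simp add: q_def l_def w_def power_divide)
    ultimately show ?thesis
      using exp_half_square_le_sum_exp_affine[of w "sqrt n"] True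
      by (simp add: weight_def w2 K_def mult.commute)
  next
    case False
    then show ?thesis
      by (simp add: weight_def sum_nonneg q_def)
  qed
  then have "(\<integral>\<^sup>+x. ennreal (weight n x) * indicator B (T n x) \<partial>P n)
      \<le> (\<integral>\<^sup>+x. ennreal (exp (1 / 2) * (\<Sum>j\<in>K. q j x)) * indicator B (T n x) \<partial>P n)"
    by (intro nn_integral_mono mult_right_mono ennreal_leI) auto
  also have "\<dots> = (\<integral>\<^sup>+x. ennreal (exp (1 / 2)) * (\<Sum>j\<in>K. indicator B (T n x) * ennreal (q j x)) \<partial>P n)"
  proof (intro nn_integral_cong)
    fix x
    have "(\<Sum>j\<in>K. indicator B (T n x) * ennreal (q j x)) = indicator B (T n x) * ennreal (\<Sum>j\<in>K. q j x)"
      by (simp add: q_nonneg flip: sum_ennreal sum_distrib_left)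
    then show "ennreal (exp (1 / 2) * (\<Sum>j\<in>K. q j x)) * indicator B (T n x)
        = ennreal (exp (1 / 2)) * (\<Sum>j\<in>K. indicator B (T n x) * ennreal (q j x))"
      by (simp add: ennreal_mult sum_nonneg q_nonneg mult_ac)
  qed
  also have "\<dots> = ennreal (exp (1 / 2)) * (\<Sum>j\<in>K. \<integral>\<^sup>+x. indicator B (T n x) * ennreal (q j x) \<partial>P n)"
    by (subst nn_integral_cmult, measurable, subst nn_integral_sum) auto
  also have "\<dots> \<le> ennreal (exp (1 / 2)) * (\<Sum>j\<in>K. \<integral>\<^sup>+x. indicator B (T n x) \<partial>P n)"
    unfolding q_def by (intro mult_left_mono sum_mono nn_integral_exp_tilt_le) auto
  also have "(\<integral>\<^sup>+x. indicator B (T n x) \<partial>P n) = (\<integral>\<^sup>+x. indicator {x \<in> space (P n). T n x \<in> B} x \<partial>P n)"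
    by (intro nn_integral_cong) (auto simp: indicator_def)
  also have "\<dots> = ennreal (measure (P n) {x \<in> space (P n). T n x \<in> B})"
    by (simp add: P.emeasure_eq_measure)
  also have "ennreal (exp (1 / 2)) * (\<Sum>j\<in>K. ennreal (measure (P n) {x \<in> space (P n). T n x \<in> B}))
      = ennreal (exp (1 / 2) * (real (card K) * measure (P n) {x \<in> space (P n). T n x \<in> B}))"
    by (simp add: ennreal_mult ennreal_of_nat_eq_real_of_nat)
  also have "\<dots> \<le> ennreal (exp (1 / 2) * (2 * sqrt n + 1) * measure (P n) {x \<in> space (P n). T n x \<in> B})"
  proof -
    have "real (card K) = 2 * of_int \<lfloor>sqrt n\<rfloor> + 1"
      by (simp add: K_def)
    also have "\<dots> \<le> 2 * sqrt n + 1"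
      by simp
    finally show ?thesis
      unfolding mult.assoc by (intro ennreal_leI mult_left_mono mult_right_mono) auto
  qed
  finally show ?thesis .
qed

section \<open>Concentration of the sum of squares\<close>

lemma
  fixes g :: "real \<Rightarrow> real"
  assumes g: "integrable \<rho> g" and i: "i \<in> {1..n}"
  shows integrable_component: "integrable (P n) (\<lambda>x. g (x i))"
    and integral_component: "(\<integral>x. g (x i) \<partial>P n) = (\<integral>z. g z \<partial>\<rho>)"
proof -
  have d: "distr (P n) \<rho> (\<lambda>x. x i) = \<rho>"
    using i by (intro distr_PiM_component) (auto intro: prob_space_axioms)
  have m: "(\<lambda>x. x i) \<in> measurable (P n) \<rho>"
    using i by (intro measurable_component_singleton) auto
  show "integrable (P n) (\<lambda>x. g (x i))"
    by (rule integrable_distr[OF m]) (simp add: d g)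
  show "(\<integral>x. g (x i) \<partial>P n) = (\<integral>z. g z \<partial>\<rho>)"
    using integral_distr[OF m, of g] g by (simp add: d)
qed

lemma integrable_and_integral_centred_product:
  fixes g :: "real \<Rightarrow> real"
  assumes g: "integrable \<rho> g" and zero: "(\<integral>z. g z \<partial>\<rho>) = 0"
    and ij: "i \<in> {1..n}" "j \<in> {1..n}" "i \<noteq> j"
  shows "integrable (P n) (\<lambda>x. g (x i) * g (x j)) \<and> (\<integral>x. g (x i) * g (x j) \<partial>P n) = 0"
proof -
  interpret prod: product_prob_space "\<lambda>_. \<rho>" "{1..n}"
    by (rule product_prob_space_P)
  \<comment> \<open>Writing the product as one over all coordinates makes the product formula applicable.\<close>
  define h where "h k z = (if k = i then g z else 1) * (if k = j then g z else 1)" for k and z :: real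
  have h: "integrable \<rho> (h k)" for k
    using g ij by (cases "k = i"; cases "k = j") (auto simp: h_def[abs_def])
  have prod_h: "(\<Prod>k\<in>{1..n}. h k (x k)) = g (x i) * g (x j)" for x
    using ij by (simp add: h_def prod.distrib prod.delta)
  have "integrable (P n) (\<lambda>x. \<Prod>k\<in>{1..n}. h k (x k))"
    by (rule prod.product_integrable_prod) (auto simp: h)
  moreover have "(\<integral>x. (\<Prod>k\<in>{1..n}. h k (x k)) \<partial>P n) = (\<Prod>k\<in>{1..n}. \<integral>z. h k z \<partial>\<rho>)"
    by (rule prod.product_integral_prod) (auto simp: h)
  moreover have "(\<Prod>k\<in>{1..n}. \<integral>z. h k z \<partial>\<rho>) = 0"
    using ij zero by (intro prod_zero bexI[of _ i]) (auto simp: h_def)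
  ultimately show ?thesis
    by (simp add: prod_h)
qed

text \<open>Chebyshev's inequality; the off-diagonal terms of the variance vanish by independence.\<close>

lemma prob_T_deviation_le:
  fixes m d :: real
  assumes fourth: "integrable \<rho> (\<lambda>z. z ^ 4)" and m: "m = expectation (\<lambda>z. z\<^sup>2)"
    and "0 < d" "1 \<le> n"
  shows "measure (P n) {x \<in> space (P n). d \<le> \<bar>T n x / n - m\<bar>}
    \<le> expectation (\<lambda>z. (z\<^sup>2 - m)\<^sup>2) / d\<^sup>2 / n"
proof -
  interpret P: prob_space "P n" by (rule prob_space_P)
  define g where "g z = z\<^sup>2 - m" for z
  define V where "V = expectation (\<lambda>z. (g z)\<^sup>2)"
  have second: "integrable \<rho> (\<lambda>z. z\<^sup>2)"
    by (rule square_integrable_imp_integrable) (use fourth in simp_all)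
  have g: "integrable \<rho> g" and g0: "(\<integral>z. g z \<partial>\<rho>) = 0"
    using second prob_space by (simp_all add: g_def[abs_def] m)
  have "integrable \<rho> (\<lambda>z. z ^ 4 - 2 * m * z\<^sup>2 + m\<^sup>2)"
    using second fourth by simp
  moreover have "z ^ 4 - 2 * m * z\<^sup>2 + m\<^sup>2 = g z * g z" for z
    by (simp add: g_def power2_eq_square power4_eq_xxxx algebra_simps)
  ultimately have gg: "integrable \<rho> (\<lambda>z. g z * g z)"
    by simp
  have pair: "integrable (P n) (\<lambda>x. g (x i) * g (x j))"
    "(\<integral>x. g (x i) * g (x j) \<partial>P n) = (if i = j then V else 0)"
    if "i \<in> {1..n}" "j \<in> {1..n}" for i j
    using integrable_and_integral_centred_product[OF g g0 that]
      integrable_component[OF gg that(1)] integral_component[OF gg that(1)]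
    by (auto simp: V_def power2_eq_square)
  have dev: "T n x - n * m = (\<Sum>i\<in>{1..n}. g (x i))" for x
    by (simp add: T_def g_def sum_subtractf)
  have sq: "(T n x - n * m)\<^sup>2 = (\<Sum>i\<in>{1..n}. \<Sum>j\<in>{1..n}. g (x i) * g (x j))" for x
    unfolding dev power2_eq_square by (rule sum_product)
  have int_sq: "integrable (P n) (\<lambda>x. (T n x - n * m)\<^sup>2)"
    unfolding sq by (intro Bochner_Integration.integrable_sum pair)
  have "(\<integral>x. (T n x - n * m)\<^sup>2 \<partial>P n) = (\<Sum>i\<in>{1..n}. \<integral>x. (\<Sum>j\<in>{1..n}. g (x i) * g (x j)) \<partial>P n)"
    unfolding sq
    by (intro Bochner_Integration.integral_sum Bochner_Integration.integrable_sum pair)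
  also have "\<dots> = (\<Sum>i\<in>{1..n}. \<Sum>j\<in>{1..n}. \<integral>x. g (x i) * g (x j) \<partial>P n)"
    by (intro sum.cong refl Bochner_Integration.integral_sum pair)
  also have "\<dots> = (\<Sum>i\<in>{1..n}. \<Sum>j\<in>{1..n}. if i = j then V else 0)"
    by (intro sum.cong refl pair)
  also have "\<dots> = n * V"
    by simp
  finally have var: "(\<integral>x. (T n x - n * m)\<^sup>2 \<partial>P n) = n * V" .
  have int_T: "integrable (P n) (\<lambda>x. T n x - n * m)"
    by (rule P.square_integrable_imp_integrable) (use int_sq in simp_all)
  have "(\<integral>x. T n x - n * m \<partial>P n) = 0"
    unfolding dev using integrable_component[OF g] integral_component[OF g] g0
    by (simp add: Bochner_Integration.integral_sum)
  then have "measure (P n) {x \<in> space (P n). n * d \<le> \<bar>T n x - n * m\<bar>} \<le> n * V / (n * d)\<^sup>2"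
    using P.Chebyshev_inequality[of "\<lambda>x. T n x - n * m" "n * d"] int_sq var assms by simp
  also have "n * V / (n * d)\<^sup>2 = V / d\<^sup>2 / n"
    using assms by (simp add: power2_eq_square field_simps)
  also have "{x \<in> space (P n). n * d \<le> \<bar>T n x - n * m\<bar>} = {x \<in> space (P n). d \<le> \<bar>T n x / n - m\<bar>}"
  proof -
    have "T n x / n - m = (T n x - n * m) / n" for x
      using \<open>1 \<le> n\<close> by (simp add: diff_divide_distrib)
    then have "\<bar>T n x / n - m\<bar> = \<bar>T n x - n * m\<bar> / n" for x
      by (simp add: abs_divide)
    then show ?thesis
      using assms by (simp add: le_divide_eq mult.commute)
  qed
  finally show ?thesis
    by (simp add: V_def g_def)
qed

section \<open>The region where the slope is bounded away from zero\<close>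

lemma exp_tilt_bounded: "exp (u * z - u\<^sup>2 * z\<^sup>2 / 2) \<le> exp (1 / 2)" for u z :: real
proof -
  have "0 \<le> (u * z - 1)\<^sup>2" by simp
  then show ?thesis by (simp add: power2_eq_square algebra_simps)
qed

lemma integrable_exp_tilt: "integrable \<rho> (\<lambda>z. exp (u * z - u\<^sup>2 * z\<^sup>2 / 2))" 
proof (rule integrable_const_bound[where B = "exp (1 / 2)"])
  show "AE z in \<rho>. norm (exp (u * z - u\<^sup>2 * z\<^sup>2 / 2)) \<le> exp (1 / 2)"
    by (rule AE_I2) (simp only: real_norm_def abs_exp_cancel exp_tilt_bounded)
qed simp

text \<open>By symmetry the expectation is that of \<open>cosh (u z) * exp (- (u z)\<^sup>2 / 2)\<close>, which is less than 1
  except where \<open>z = 0\<close>; a positive second moment excludes \<open>z = 0\<close> almost surely.\<close>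

lemma expectation_exp_tilt_less_1:
  assumes "u \<noteq> 0" and second: "integrable \<rho> (\<lambda>z. z\<^sup>2)" "0 < expectation (\<lambda>z. z\<^sup>2)"
  shows "expectation (\<lambda>z. exp (u * z - u\<^sup>2 * z\<^sup>2 / 2)) < 1"
proof -
  define e where "e v z = exp (v * z - u\<^sup>2 * z\<^sup>2 / 2)" for v z :: real
  define k where "k z = 1 - (e u z + e (- u) z) / 2" for z
  have int_e: "integrable \<rho> (e u)" "integrable \<rho> (e (- u))"
    using integrable_exp_tilt[of u] integrable_exp_tilt[of "- u"] by (simp_all add: e_def[abs_def])
  have k_eq: "k z = 1 - cosh (u * z) / exp ((u * z)\<^sup>2 / 2)" for z
    by (simp add: k_def e_def cosh_def exp_diff power_mult_distrib add_divide_distrib)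
  have k_nonneg: "0 \<le> k z" for z
    using cosh_le_exp_half_square[of "u * z"] by (simp add: k_eq)
  have k_pos: "0 < k z" if "z \<noteq> 0" for z
    using cosh_less_exp_half_square[of "u * z"] that assms by (simp add: k_eq)
  have int_k: "integrable \<rho> k"
    unfolding k_def[abs_def] using int_e by simp
  have "expectation k \<noteq> 0"
  proof
    assume "expectation k = 0"
    then have "AE z in \<rho>. k z = 0"
      using integral_nonneg_eq_0_iff_AE[OF int_k] k_nonneg by simp
    then have "AE z in \<rho>. z\<^sup>2 = 0"
      by eventually_elim (use k_pos in fastforce)
    then have "expectation (\<lambda>z. z\<^sup>2) = 0"
      by (subst integral_nonneg_eq_0_iff_AE[OF second(1)]) auto
    with second(2) show False by simp
  qed
  moreover have "0 \<le> expectation k"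
    using k_nonneg by (intro Bochner_Integration.integral_nonneg) auto
  moreover have "expectation (e (- u)) = expectation (e u)"
  proof -
    have "expectation (e u) = (\<integral>z. e u z \<partial>distr \<rho> borel uminus)"
      by (simp add: distr_uminus)
    also have "\<dots> = expectation (\<lambda>z. e u (- z))"
      by (rule integral_distr) (simp_all add: e_def[abs_def])
    finally show ?thesis
      by (simp add: e_def[abs_def])
  qed
  ultimately show ?thesis
    using int_e prob_space by (simp add: k_def[abs_def] e_def[abs_def])
qed

text \<open>Replacing the random slope \<open>S / T\<close> by a constant \<open>u\<close> within distance \<open>h\<close> costs
  \<open>T h\<^sup>2 / 2 \<le> n k h\<^sup>2 / 2\<close> in the exponent, and what remains is a product over the coordinates.\<close>

lemma nn_integral_weight_slope_near_le:
  fixes A :: "(nat \<Rightarrow> real) set" and k u h :: real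
  assumes [measurable]: "A \<in> sets (P n)"
    and A: "\<And>x. x \<in> A \<Longrightarrow> 0 < T n x \<and> T n x \<le> k * n \<and> \<bar>S n x / T n x - u\<bar> \<le> h"
  shows "(\<integral>\<^sup>+x. ennreal (weight n x) * indicator A x \<partial>P n)
    \<le> ennreal ((exp (k * h\<^sup>2 / 2) * expectation (\<lambda>z. exp (u * z - u\<^sup>2 * z\<^sup>2 / 2))) ^ n)"
proof -
  interpret prod: product_prob_space "\<lambda>_. \<rho>" "{1..n}"
    by (rule product_prob_space_P)
  define e where "e z = exp (k * h\<^sup>2 / 2) * exp (u * z - u\<^sup>2 * z\<^sup>2 / 2)" for z :: real
  have e_borel [measurable]: "e \<in> borel_measurable borel"
    unfolding e_def by measurable
  have "weight n x \<le> (\<Prod>i\<in>{1..n}. e (x i))" if "x \<in> A" for x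
  proof -
    define s where "s = S n x / T n x"
    have T: "0 < T n x" "T n x \<le> k * n" and s: "\<bar>s - u\<bar> \<le> h"
      using A[OF that] by (auto simp: s_def)
    have "(S n x)\<^sup>2 / T n x / 2 = (u * S n x - u\<^sup>2 * T n x / 2) + T n x * (s - u)\<^sup>2 / 2"
      using T by (simp add: s_def power2_eq_square field_simps)
    also have "T n x * (s - u)\<^sup>2 \<le> k * n * h\<^sup>2"
      using T s by (intro mult_mono) (auto simp flip: abs_le_square_iff)
    finally have "(S n x)\<^sup>2 / T n x / 2 \<le> (u * S n x - u\<^sup>2 * T n x / 2) + n * (k * h\<^sup>2 / 2)"
      by (simp add: mult_ac)
    also have "\<dots> = (\<Sum>i\<in>{1..n}. k * h\<^sup>2 / 2 + (u * x i - u\<^sup>2 * (x i)\<^sup>2 / 2))"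
      by (simp add: S_def T_def sum.distrib sum_subtractf sum_distrib_left sum_divide_distrib)
    finally have "exp ((S n x)\<^sup>2 / T n x / 2) \<le> exp \<dots>"
      by simp
    then show ?thesis
      using T by (simp add: weight_def e_def exp_sum mult.commute flip: exp_add)
  qed
  then have "(\<integral>\<^sup>+x. ennreal (weight n x) * indicator A x \<partial>P n)
      \<le> (\<integral>\<^sup>+x. (\<Prod>i\<in>{1..n}. ennreal (e (x i))) \<partial>P n)"
    by (intro nn_integral_mono)
       (auto simp: indicator_def prod_ennreal e_def intro!: ennreal_leI)
  also have "\<dots> = (\<Prod>i\<in>{1..n}. \<integral>\<^sup>+z. ennreal (e z) \<partial>\<rho>)"
    by (rule prod.product_nn_integral_prod) auto
  also have "(\<integral>\<^sup>+z. ennreal (e z) \<partial>\<rho>) = ennreal (expectation e)"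
    unfolding e_def using integrable_exp_tilt by (intro nn_integral_eq_integral) auto
  also have "(\<Prod>i\<in>{1..n}. ennreal (expectation e)) = ennreal (expectation e ^ n)"
    by (simp add: ennreal_power e_def)
  also have "expectation e = exp (k * h\<^sup>2 / 2) * expectation (\<lambda>z. exp (u * z - u\<^sup>2 * z\<^sup>2 / 2))"
    unfolding e_def by simp
  finally show ?thesis .
qed

text \<open>A finite cover of \<open>K\<close> by such neighbourhoods bounds the mass by a finite sum of geometric
  sequences.\<close>

lemma nn_integral_weight_slope_tendsto_0:
  fixes K :: "real set" and k :: real
  assumes K: "compact K" "0 \<notin> K" and "0 < k"
    and second: "integrable \<rho> (\<lambda>z. z\<^sup>2)" "0 < expectation (\<lambda>z. z\<^sup>2)"
  obtains b :: "nat \<Rightarrow> real" where "b \<longlonglongrightarrow> 0"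
    "\<And>n. (\<integral>\<^sup>+x. ennreal (weight n x) *
        indicator {x \<in> space (P n). 0 < T n x \<and> T n x \<le> k * n \<and> S n x / T n x \<in> K} x \<partial>P n)
      \<le> ennreal (b n)"
proof -
  define M where "M u = expectation (\<lambda>z. exp (u * z - u\<^sup>2 * z\<^sup>2 / 2))" for u
  have M: "0 \<le> M u" "u \<noteq> 0 \<Longrightarrow> M u < 1" for u
    using expectation_exp_tilt_less_1[OF _ second] by (auto simp: M_def)
  \<comment> \<open>Around each slope the error of linearisation is made smaller than the gain \<open>- ln (M u)\<close>.\<close>
  have "\<exists>h>0. exp (k * h\<^sup>2 / 2) * M u < 1" if "u \<in> K" for u
  proof -
    have "u \<noteq> 0" using that K by auto
    have "((\<lambda>h. exp (k * h\<^sup>2 / 2) * M u) \<longlongrightarrow> exp (k * 0\<^sup>2 / 2) * M u) (at_right 0)"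
      by (intro tendsto_intros) simp
    then have "eventually (\<lambda>h. exp (k * h\<^sup>2 / 2) * M u < 1) (at_right 0)"
      using M(2)[OF \<open>u \<noteq> 0\<close>] by (intro order_tendstoD(2)) auto
    then have "eventually (\<lambda>h. 0 < h \<and> exp (k * h\<^sup>2 / 2) * M u < 1) (at_right 0)"
      using eventually_at_right_less by (rule eventually_conj[rotated])
    then show ?thesis
      using eventually_happens[of _ "at_right (0::real)"] by auto
  qed
  then obtain h where "\<forall>u\<in>K. 0 < h u \<and> exp (k * (h u)\<^sup>2 / 2) * M u < 1"
    using bchoice[of K "\<lambda>u h. 0 < h \<and> exp (k * h\<^sup>2 / 2) * M u < 1"] by blast
  then have h: "0 < h u" "exp (k * (h u)\<^sup>2 / 2) * M u < 1" if "u \<in> K" for u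
    using that by auto
  obtain D where D: "D \<subseteq> K" "finite D" "K \<subseteq> (\<Union>u\<in>D. ball u (h u))"
  proof (rule compactE_image[OF K(1), of K "\<lambda>u. ball u (h u)"])
    show "K \<subseteq> (\<Union>u\<in>K. ball u (h u))"
      using h(1) by force
  qed auto
  define b where "b n = (\<Sum>u\<in>D. (exp (k * (h u)\<^sup>2 / 2) * M u) ^ n)" for n
  have "b \<longlonglongrightarrow> (\<Sum>u\<in>D. 0)"
    unfolding b_def using h D(1) M(1) by (intro tendsto_sum LIMSEQ_realpow_zero) auto
  moreover have "(\<integral>\<^sup>+x. ennreal (weight n x) *
        indicator {x \<in> space (P n). 0 < T n x \<and> T n x \<le> k * n \<and> S n x / T n x \<in> K} x \<partial>P n)
      \<le> ennreal (b n)" for n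
  proof -
    define A where "A u = {x \<in> space (P n). 0 < T n x \<and> T n x \<le> k * n \<and> \<bar>S n x / T n x - u\<bar> \<le> h u}" for u
    have A [measurable]: "A u \<in> sets (P n)" for u
      unfolding A_def by measurable
    have w [measurable]: "weight n \<in> borel_measurable (P n)"
      by (rule weight_measurable) unfold_locales
    have "ennreal (weight n x) *
        indicator {x \<in> space (P n). 0 < T n x \<and> T n x \<le> k * n \<and> S n x / T n x \<in> K} x
      \<le> (\<Sum>u\<in>D. ennreal (weight n x) * indicator (A u) x)" for x
    proof (cases "x \<in> space (P n) \<and> 0 < T n x \<and> T n x \<le> k * n \<and> S n x / T n x \<in> K")
      case True
      then obtain u where u: "u \<in> D" "S n x / T n x \<in> ball u (h u)"
        using D(3) by blast
      then have "x \<in> A u"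
        using True by (auto simp: A_def dist_real_def)
      then have "ennreal (weight n x) \<le> ennreal (weight n x) * indicator (A u) x"
        by simp
      also have "\<dots> \<le> (\<Sum>u\<in>D. ennreal (weight n x) * indicator (A u) x)"
        using u D(2) by (intro member_le_sum) auto
      finally show ?thesis
        using True by simp
    qed auto
    then have "(\<integral>\<^sup>+x. ennreal (weight n x) *
        indicator {x \<in> space (P n). 0 < T n x \<and> T n x \<le> k * n \<and> S n x / T n x \<in> K} x \<partial>P n)
      \<le> (\<integral>\<^sup>+x. (\<Sum>u\<in>D. ennreal (weight n x) * indicator (A u) x) \<partial>P n)"
      by (intro nn_integral_mono)
    also have "\<dots> = (\<Sum>u\<in>D. \<integral>\<^sup>+x. ennreal (weight n x) * indicator (A u) x \<partial>P n)"
      by (rule nn_integral_sum) measurable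
    also have "\<dots> \<le> (\<Sum>u\<in>D. ennreal ((exp (k * (h u)\<^sup>2 / 2) * M u) ^ n))"
      unfolding M_def
      by (intro sum_mono nn_integral_weight_slope_near_le A) (auto simp: A_def)
    also have "\<dots> = ennreal (b n)"
      unfolding b_def using M(1) by (intro sum_ennreal) auto
    finally show ?thesis .
  qed
  ultimately show ?thesis
    using that by simp
qed

section \<open>Concentration of the reweighted measure\<close>

lemma expectation_eq_0: "expectation (\<lambda>z. z) = 0"
proof -
  have "expectation (\<lambda>z. z) = (\<integral>z. z \<partial>distr \<rho> borel uminus)"
    by (simp only: distr_uminus)
  also have "\<dots> = - expectation (\<lambda>z. z)"
    by (subst integral_distr) simp_all
  finally show ?thesis by simp
qed

lemma integrable_power4_if_exp_square:
  assumes "0 < v" and int: "integrable \<rho> (\<lambda>z. exp (v * z\<^sup>2))"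
  shows "integrable \<rho> (\<lambda>z. z ^ 4)"
proof (rule Bochner_Integration.integrable_bound)
  show "integrable \<rho> (\<lambda>z. 2 / v\<^sup>2 * exp (v * z\<^sup>2))"
    using int by simp
  have "z ^ 4 \<le> 2 / v\<^sup>2 * exp (v * z\<^sup>2)" for z :: real
  proof -
    have "(v * z\<^sup>2)\<^sup>2 / 2 \<le> exp (v * z\<^sup>2)"
    proof -
      have "0 \<le> v * z\<^sup>2"
        using assms(1) by simp
      with exp_lower_Taylor_quadratic[OF this] show ?thesis
        by linarith
    qed
    then show ?thesis
      using assms(1) by (simp add: field_simps power_mult_distrib flip: power_mult)
  qed
  then show "AE z in \<rho>. norm (z ^ 4) \<le> norm (2 / v\<^sup>2 * exp (v * z\<^sup>2))"
    by (intro AE_I2) simp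
qed simp

lemma measure_mu_tilde_le:
  assumes [measurable]: "A \<in> sets (P n)" and "1 / 2 \<le> Z \<rho> n" "0 \<le> r"
    and le: "(\<integral>\<^sup>+x. ennreal (weight n x) * indicator A x \<partial>P n) \<le> ennreal r"
  shows "measure (mu_tilde \<rho> n) A \<le> 2 * r"
proof -
  have w [measurable]: "weight n \<in> borel_measurable (P n)"
    by (rule weight_measurable) unfold_locales
  have "emeasure (mu_tilde \<rho> n) A = (\<integral>\<^sup>+x. ennreal (1 / Z \<rho> n * weight n x) * indicator A x \<partial>P n)"
    unfolding mu_tilde_def by (rule emeasure_density) measurable
  also have "\<dots> \<le> (\<integral>\<^sup>+x. ennreal 2 * (ennreal (weight n x) * indicator A x) \<partial>P n)"
  proof (rule nn_integral_mono)
    fix x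
    have "1 / Z \<rho> n * weight n x \<le> 2 * weight n x"
      using assms(2) by (intro mult_right_mono weight_nonneg) (simp add: field_simps)
    then have "ennreal (1 / Z \<rho> n * weight n x) \<le> ennreal 2 * ennreal (weight n x)"
      by (subst ennreal_mult[symmetric]) (auto simp: weight_nonneg intro!: ennreal_leI)
    then show "ennreal (1 / Z \<rho> n * weight n x) * indicator A x
        \<le> ennreal 2 * (ennreal (weight n x) * indicator A x)"
      by (simp add: indicator_def)
  qed
  also have "\<dots> = ennreal 2 * (\<integral>\<^sup>+x. ennreal (weight n x) * indicator A x \<partial>P n)"
    by (rule nn_integral_cmult) measurable
  also have "\<dots> \<le> ennreal 2 * ennreal r"
    by (intro mult_left_mono le) simp
  also have "\<dots> = ennreal (2 * r)"
    using \<open>0 \<le> r\<close> by (simp add: ennreal_mult)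
  finally show ?thesis
    using \<open>0 \<le> r\<close> by (simp add: measure_def enn2real_leI)
qed

text \<open>The deviation event contains \<open>{T \<le> 0}\<close> because \<open>d < m\<close>, and off it the weight is at least 1.\<close>

lemma Z_ge:
  assumes "0 < d" "d < m" "1 \<le> n"
  shows "1 - measure (P n) {x \<in> space (P n). d \<le> \<bar>T n x / n - m\<bar>} \<le> Z \<rho> n"
proof -
  interpret P: prob_space "P n" by (rule prob_space_P)
  define D where "D = {x \<in> space (P n). d \<le> \<bar>T n x / n - m\<bar>}"
  have D [measurable]: "D \<in> sets (P n)"
    unfolding D_def by measurable
  have "1 - indicator D x \<le> weight n x" if "x \<in> space (P n)" for x
  proof (cases "x \<in> D")
    case False
    then have "0 < T n x / n"
      using that assms by (simp add: D_def)
    then have "0 < T n x"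
      using assms by (simp add: zero_less_divide_iff)
    then show ?thesis
      using False by (simp add: weight_def)
  qed (simp add: weight_nonneg)
  moreover have "integrable (P n) (weight n)"
    by (rule weight_integrable) unfold_locales
  ultimately have "(\<integral>x. 1 - indicator D x \<partial>P n) \<le> Z \<rho> n"
    unfolding Z_def by (intro integral_mono) (auto simp: less_top[symmetric])
  moreover have "(\<integral>x. 1 - indicator D x \<partial>P n) = 1 - measure (P n) D"
    using P.prob_space by (subst Bochner_Integration.integral_diff) (auto simp: less_top[symmetric])
  ultimately show ?thesis
    by (simp add: D_def)
qed

text \<open>The two regions together. \<open>K\<close> contains the slopes that occur in the second one: there
  \<open>T \<le> k n\<close> bounds \<open>\<bar>S / T\<bar>\<close> below by \<open>e / k\<close>, and \<open>S\<^sup>2 \<le> n T\<close> with \<open>T > (m - d) n\<close> bounds it above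
  by \<open>R\<close>. The sequence \<open>c\<close> estimates the first region and \<open>b\<close> the second.\<close>

lemma mu_tilde_outside_box_tendsto_0:
  fixes m d e :: real
  assumes fourth: "integrable \<rho> (\<lambda>z. z ^ 4)" and m: "m = expectation (\<lambda>z. z\<^sup>2)"
    and "0 < d" "d < m" "0 < e"
  shows "(\<lambda>n. measure (mu_tilde \<rho> n)
      {x \<in> space (P n). d \<le> \<bar>T n x / n - m\<bar> \<or> e \<le> \<bar>S n x / n\<bar>}) \<longlonglongrightarrow> 0"
proof -
  define V where "V = expectation (\<lambda>z. (z\<^sup>2 - m)\<^sup>2)"
  define k where "k = m + d"
  define R where "R = sqrt (1 / (m - d))"
  define K where "K = cball 0 R - ball (0 :: real) (e / k)"
  define E where "E n = {x \<in> space (P n). d \<le> \<bar>T n x / n - m\<bar> \<or> e \<le> \<bar>S n x / n\<bar>}" for n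
  define c where "c n = exp (1 / 2) * (2 * sqrt n + 1) * (V / d\<^sup>2 / n)" for n :: nat
  have "0 < k" using assms by (simp add: k_def)
  have "0 \<le> V" by (simp add: V_def)
  have second: "integrable \<rho> (\<lambda>z. z\<^sup>2)"
    by (rule square_integrable_imp_integrable) (use fourth in simp_all)
  have K: "compact K" "0 \<notin> K"
    using \<open>0 < k\<close> \<open>0 < e\<close> by (auto simp: K_def intro!: compact_diff)
  then have K_borel [measurable]: "K \<in> sets borel"
    by (intro borel_closed compact_imp_closed)
  obtain b where b: "b \<longlonglongrightarrow> 0"
    "\<And>n. (\<integral>\<^sup>+x. ennreal (weight n x) *
        indicator {x \<in> space (P n). 0 < T n x \<and> T n x \<le> k * n \<and> S n x / T n x \<in> K} x \<partial>P n)
      \<le> ennreal (b n)"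
    using nn_integral_weight_slope_tendsto_0[OF K \<open>0 < k\<close> second] assms by auto
  have deviation: "measure (P n) {x \<in> space (P n). d \<le> \<bar>T n x / n - m\<bar>} \<le> V / d\<^sup>2 / n" if "1 \<le> n" for n
    unfolding V_def by (rule prob_T_deviation_le[OF fourth m \<open>0 < d\<close> that])
  have numerator: "(\<integral>\<^sup>+x. ennreal (weight n x) * indicator (E n) x \<partial>P n) \<le> ennreal (c n + \<bar>b n\<bar>)"
    if n: "1 \<le> n" for n
  proof -
    define B where "B = {t. d \<le> \<bar>t / n - m\<bar>}"
    define A where "A = {x \<in> space (P n). 0 < T n x \<and> T n x \<le> k * n \<and> S n x / T n x \<in> K}"
    have B [measurable]: "B \<in> sets borel"
      unfolding B_def by measurable
    have A [measurable]: "A \<in> sets (P n)"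
      unfolding A_def by measurable
    have w [measurable]: "weight n \<in> borel_measurable (P n)"
      by (rule weight_measurable) unfold_locales
    have cover: "T n x \<in> B \<or> x \<in> A" if x: "x \<in> E n" for x
    proof (cases "T n x \<in> B")
      case False
      then have T: "(m - d) * n < T n x" "T n x < k * n" and S: "e * n \<le> \<bar>S n x\<bar>"
        using x n by (auto simp: B_def E_def k_def abs_less_iff abs_divide field_simps)
      have T_pos: "0 < T n x"
        using T(1) assms n by (smt (verit) mult_nonneg_nonneg of_nat_0_le_iff)
      have "(S n x / T n x)\<^sup>2 \<le> 1 / (m - d)"
      proof -
        have "(S n x)\<^sup>2 * (m - d) \<le> real n * T n x * (m - d)"
          using assms by (intro mult_right_mono S_square_le) auto
        also have "\<dots> = (m - d) * n * T n x"
          by simp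
        also have "\<dots> \<le> T n x * T n x"
          using T T_pos by (intro mult_right_mono) auto
        finally show ?thesis
          using T_pos assms by (simp add: power2_eq_square field_simps)
      qed
      then have upper: "\<bar>S n x / T n x\<bar> \<le> R"
        unfolding R_def by (intro real_le_rsqrt) (simp only: power2_abs)
      have "e / k * T n x \<le> e / k * (k * n)"
        using T assms \<open>0 < k\<close> by (intro mult_left_mono) auto
      also have "\<dots> \<le> \<bar>S n x\<bar>"
        using S \<open>0 < k\<close> by simp
      finally have "e / k \<le> \<bar>S n x / T n x\<bar>"
        using T_pos by (simp add: abs_divide le_divide_eq)
      with upper have "S n x / T n x \<in> K"
        by (simp add: K_def)
      then show ?thesis
        using x T T_pos by (simp add: A_def E_def)
    qed simp
    have "(\<integral>\<^sup>+x. ennreal (weight n x) * indicator (E n) x \<partial>P n)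
        \<le> (\<integral>\<^sup>+x. ennreal (weight n x) * indicator B (T n x) + ennreal (weight n x) * indicator A x \<partial>P n)"
      by (intro nn_integral_mono) (use cover in \<open>auto simp: indicator_def\<close>)
    also have "\<dots> = (\<integral>\<^sup>+x. ennreal (weight n x) * indicator B (T n x) \<partial>P n)
        + (\<integral>\<^sup>+x. ennreal (weight n x) * indicator A x \<partial>P n)"
      by (rule nn_integral_add) measurable
    also have "\<dots> \<le> ennreal (exp (1 / 2) * (2 * sqrt n + 1) * measure (P n) {x \<in> space (P n). T n x \<in> B})
        + ennreal (b n)"
      using b(2)[of n] by (intro add_mono nn_integral_weight_T_in_le B) (simp add: A_def)
    also have "\<dots> \<le> ennreal (c n) + ennreal \<bar>b n\<bar>"
      using deviation[OF n] unfolding c_def B_def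
      by (intro add_mono ennreal_leI mult_left_mono) auto
    also have "\<dots> = ennreal (c n + \<bar>b n\<bar>)"
      using \<open>0 \<le> V\<close> by (simp add: c_def)
    finally show ?thesis .
  qed
  have inverse_n: "(\<lambda>n. inverse (real n)) \<longlonglongrightarrow> 0"
    by (rule lim_inverse_n)
  have "(\<lambda>n. exp (1 / 2) * (V / d\<^sup>2) * (2 * sqrt (inverse (real n)) + inverse (real n)))
      \<longlonglongrightarrow> exp (1 / 2) * (V / d\<^sup>2) * (2 * sqrt 0 + 0)"
    by (intro tendsto_intros inverse_n)
  moreover have "c = (\<lambda>n. exp (1 / 2) * (V / d\<^sup>2) * (2 * sqrt (inverse (real n)) + inverse (real n)))"
  proof (rule ext)
    fix n
    have "sqrt (inverse (real n)) = sqrt n / n"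
      by (simp add: real_sqrt_inverse inverse_eq_divide real_sqrt_divide sqrt_divide_self_eq)
    then have "2 * sqrt (inverse (real n)) + inverse (real n) = (2 * sqrt n + 1) / n"
      by (simp add: add_divide_distrib inverse_eq_divide)
    then show "c n = exp (1 / 2) * (V / d\<^sup>2) * (2 * sqrt (inverse (real n)) + inverse (real n))"
      by (simp only: c_def) (simp only: times_divide_eq_left times_divide_eq_right mult_ac divide_divide_eq_left)
  qed
  ultimately have "c \<longlonglongrightarrow> 0"
    by simp
  then have bound: "(\<lambda>n. 2 * (c n + \<bar>b n\<bar>)) \<longlonglongrightarrow> 0"
    using b(1) by (auto intro!: tendsto_eq_intros)
  have "(\<lambda>n. V / d\<^sup>2 * inverse (real n)) \<longlonglongrightarrow> V / d\<^sup>2 * 0"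
    by (intro tendsto_intros inverse_n)
  then have "eventually (\<lambda>n. V / d\<^sup>2 * inverse (real n) < 1 / 2) sequentially"
    by (intro order_tendstoD(2)) auto
  then have "eventually (\<lambda>n. measure (mu_tilde \<rho> n) (E n) \<le> 2 * (c n + \<bar>b n\<bar>)) sequentially"
    using eventually_ge_at_top[of 1]
  proof eventually_elim
    case (elim n)
    show ?case
    proof (rule measure_mu_tilde_le)
      show "E n \<in> sets (P n)"
        unfolding E_def by measurable
      show "1 / 2 \<le> Z \<rho> n"
        using Z_ge[OF \<open>0 < d\<close> \<open>d < m\<close> elim(2)] deviation[OF elim(2)]
          elim(1)[folded divide_inverse]
        by linarith
      show "0 \<le> c n + \<bar>b n\<bar>"
        using \<open>0 \<le> V\<close> by (simp add: c_def)
    qed (rule numerator[OF elim(2)])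
  qed
  then have "(\<lambda>n. measure (mu_tilde \<rho> n) (E n)) \<longlonglongrightarrow> 0"
    by (intro tendsto_sandwich[OF _ _ tendsto_const bound]) auto
  then show ?thesis
    by (simp add: E_def)
qed

end

section \<open>Convergence in probability\<close>

theorem theorem1:
  fixes \<rho> :: "real measure" and \<sigma> :: real
  assumes "real_distribution \<rho>"
    and "symmetric_measure \<rho>"
    and "\<sigma> > 0"
    and "prob_space.variance \<rho> (\<lambda>z. z) = \<sigma>\<^sup>2"
    and "\<exists>v\<^sub>0>0. integrable \<rho> (\<lambda>z. exp (v\<^sub>0 * z\<^sup>2))"
    and "has_lebesgue_density \<rho> \<or>
         finite_sum_of_diracs \<rho> \<or>
         (\<exists>c>0. measure \<rho> {0<..<c} = 0) \<or>
         measure \<rho> {0} < 1 / sqrt (exp 1)"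
  shows "\<forall>U :: (real \<times> real) set. open U \<and> (0, \<sigma>\<^sup>2) \<in> U \<longrightarrow>
           (\<lambda>n. measure (mu_tilde \<rho> n)
                  {x \<in> space (mu_tilde \<rho> n). (S n x / real n, T n x / real n) \<in> - U})
             \<longlonglongrightarrow> 0"
proof (intro allI impI)
  fix U :: "(real \<times> real) set"
  assume U: "open U \<and> (0, \<sigma>\<^sup>2) \<in> U"
  interpret symmetric_distribution \<rho>
    using assms(1,2) by (simp add: symmetric_distribution_def symmetric_distribution_axioms_def)
  have fourth: "integrable \<rho> (\<lambda>z. z ^ 4)"
    using assms(5) integrable_power4_if_exp_square by blast
  have m: "\<sigma>\<^sup>2 = expectation (\<lambda>z. z\<^sup>2)"
    using assms(4) by (simp add: expectation_eq_0)
  obtain A B where AB: "open A" "open B" "(0, \<sigma>\<^sup>2) \<in> A \<times> B" "A \<times> B \<subseteq> U"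
    using open_prod_elim[of U "(0, \<sigma>\<^sup>2)"] U by metis
  obtain e where e: "0 < e" "ball 0 e \<subseteq> A"
    using openE[OF AB(1), of 0] AB(3) by auto
  obtain d' where d': "0 < d'" "ball (\<sigma>\<^sup>2) d' \<subseteq> B"
    using openE[OF AB(2), of "\<sigma>\<^sup>2"] AB(3) by auto
  \<comment> \<open>A box of half-height less than \<open>\<sigma>\<^sup>2\<close> stays away from \<open>T = 0\<close>.\<close>
  define d where "d = min d' (\<sigma>\<^sup>2 / 2)"
  have "0 < \<sigma>\<^sup>2" using assms(3) by simp
  then have d: "0 < d" "d < \<sigma>\<^sup>2" "d \<le> d'"
    using d' by (auto simp: d_def min_def)
  define E where "E n = {x \<in> space (P n). d \<le> \<bar>T n x / n - \<sigma>\<^sup>2\<bar> \<or> e \<le> \<bar>S n x / n\<bar>}" for n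
  have E: "E n \<in> sets (mu_tilde \<rho> n)" for n
    unfolding mu_tilde_def sets_density E_def by measurable
  have sub: "{x \<in> space (mu_tilde \<rho> n). (S n x / real n, T n x / real n) \<in> - U} \<subseteq> E n" for n
  proof
    fix x
    assume x: "x \<in> {x \<in> space (mu_tilde \<rho> n). (S n x / real n, T n x / real n) \<in> - U}"
    show "x \<in> E n"
    proof (rule ccontr)
      assume "x \<notin> E n"
      moreover have "x \<in> space (P n)"
        using x by (simp add: mu_tilde_def)
      ultimately have "\<bar>T n x / n - \<sigma>\<^sup>2\<bar> < d" "\<bar>S n x / n\<bar> < e"
        unfolding E_def by (simp_all only: mem_Collect_eq de_Morgan_conj de_Morgan_disj not_le simp_thms)
      then have "S n x / n \<in> ball 0 e" "T n x / n \<in> ball (\<sigma>\<^sup>2) d'"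
        using d(3) unfolding mem_ball dist_real_def by linarith+
      then have "(S n x / n, T n x / n) \<in> U"
        using e(2) d'(2) AB(4) by blast
      then show False
        using x by blast
    qed
  qed
  \<comment> \<open>Monotonicity of \<open>measure\<close> needs finiteness, which holds once \<open>mu_tilde\<close> is a probability.\<close>
  have fin: "emeasure (mu_tilde \<rho> n) (E n) \<noteq> \<infinity>" if "1 \<le> n" for n
  proof -
    have "\<rho> \<noteq> return borel 0"
    proof
      assume "\<rho> = return borel 0"
      then have "expectation (\<lambda>z. z\<^sup>2) = 0"
        using integral_return[of "0 :: real" borel "\<lambda>z. z\<^sup>2"] by simp
      then show False
        using m \<open>0 < \<sigma>\<^sup>2\<close> by simp
    qed
    then interpret mu: prob_space "mu_tilde \<rho> n"
      by (rule prob_space_mu_tilde[OF assms(1) _ that])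
    show ?thesis
      by simp
  qed
  have "eventually (\<lambda>n. norm (measure (mu_tilde \<rho> n)
      {x \<in> space (mu_tilde \<rho> n). (S n x / real n, T n x / real n) \<in> - U})
      \<le> measure (mu_tilde \<rho> n) (E n)) sequentially"
    using eventually_ge_at_top[of 1]
  proof eventually_elim
    case (elim n)
    show ?case
      using fin[OF elim] emeasure_mono[OF sub E]
      by (simp add: measure_def enn2real_mono less_top)
  qed
  moreover have "(\<lambda>n. measure (mu_tilde \<rho> n) (E n)) \<longlonglongrightarrow> 0"
    unfolding E_def by (rule mu_tilde_outside_box_tendsto_0[OF fourth m d(1,2) e(1)])
  ultimately show "(\<lambda>n. measure (mu_tilde \<rho> n)
      {x \<in> space (mu_tilde \<rho> n). (S n x / real n, T n x / real n) \<in> - U}) \<longlonglongrightarrow> 0"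
    by (rule Lim_null_comparison)
qed

end
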